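(* Let $K$ be a compact Hausdorff space, $X$ a uniformly convex complex Banach space, $A(K,X)$ a function space over the base algebra $A$, and let $\Gamma$ be the Shilov boundary of $A$. Let $\Gamma'$ be the set of limit points of $\Gamma$, and let $\Gamma_0$ be the Choquet boundary of $A$. If $\Gamma'\cap\Gamma_0\neq\emptyset$, then $A(K,X)$ has the convex-DLD2P.
   Context: $C(K)$ and $C(K,X)$ are the spaces of continuous complex-valued, respectively $X$-valued, functions on $K$ with the supremum norm. A uniform algebra on $K$ is a closed subalgebra of $C(K)$ that separates the points of $K$ and contains the constant functions. A subspace $A(K,X)$ of $C(K,X)$ is called a function space over the base algebra $A$ if: (i) $A := \{x^*\circ f : x^* \in X^*, f \in A(K,X)\}$ is a uniform algebra on $K$; (ii) $A\otimes X := \{f\otimes x : f\in A, x\in X\} \subset A(K,X)$, where $(f\otimes x)(t)=f(t)x$; (iii) $g\cdot f \in A(K,X)$ for every $g\in A$ and $f\in A(K,X)$. A subset $L\subset K$ is a boundary for $A$ if for every $f\in A$ there is $t\in L$ with $|f(t)|=\|f\|_\infty$; the Shilov boundary $\Gamma$ is the smallest closed boundary. The Choquet boundary $\Gamma_0$ is the set of strong boundary points of $A$: points $x\in K$ such that for every open $U\subset K$ containing $x$ there is $f\in A$ with $\|f\|_\infty=|f(x)|=1$ and $\sup_{t\in K\setminus U}|f(t)|<1$. (Equivalently, the points whose evaluation functionals are extreme points of $\{\lambda\in A^*:\|\lambda\|=\lambda(1_A)=1\}$, where $1_A$ is the unit of $A$.) For a space $Z$ with closed unit ball $B_Z$ and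 unit sphere $S_Z$, a point $x\in S_Z$ is a $\Delta$-point if $x\in\overline{\mathrm{conv}}\{y\in B_Z:\|x-y\|\ge 2-\epsilon\}$ for every $\epsilon>0$; $\Delta_Z$ is the set of all $\Delta$-points. $Z$ has the convex diametral local diameter two property (convex-DLD2P) if $\overline{\mathrm{conv}}\,\Delta_Z=B_Z$. *)

theory Defs
  imports "HOL-Analysis.Analysis"
begin

section \<open>Complex normed spaces\<close>

class complex_normed_vector = real_normed_vector +
  fixes scaleC :: "complex \<Rightarrow> 'a \<Rightarrow> 'a" (infixr \<open>*\<^sub>C\<close> 75)
  assumes scaleC_add_right: "a *\<^sub>C (x + y) = a *\<^sub>C x + a *\<^sub>C y"
    and scaleC_add_left: "(a + b) *\<^sub>C x = a *\<^sub>C x + b *\<^sub>C x"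
    and scaleC_scaleC: "a *\<^sub>C (b *\<^sub>C x) = (a * b) *\<^sub>C x"
    and scaleC_of_real: "complex_of_real r *\<^sub>C x = r *\<^sub>R x"
    and norm_scaleC: "norm (a *\<^sub>C x) = cmod a * norm x"

instantiation complex :: complex_normed_vector
begin

definition scaleC_complex :: "complex \<Rightarrow> complex \<Rightarrow> complex" where
  "scaleC_complex a x = a * x"

instance
  by standard (auto simp: scaleC_complex_def algebra_simps norm_mult scaleR_conv_of_real)

end

definition csubspace :: "'a::complex_normed_vector set \<Rightarrow> bool" where
  "csubspace S \<longleftrightarrow> 0 \<in> S \<and> (\<forall>x\<in>S. \<forall>y\<in>S. x + y \<in> S) \<and> (\<forall>c. \<forall>x\<in>S. c *\<^sub>C x \<in> S)"

definition dual_functional :: "('a::complex_normed_vector \<Rightarrow> complex) \<Rightarrow> bool" where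
  "dual_functional \<phi> \<longleftrightarrow> bounded_linear \<phi> \<and> (\<forall>c x. \<phi> (c *\<^sub>C x) = c * \<phi> x)"

definition uniformly_convex :: "'a::real_normed_vector set \<Rightarrow> bool" where
  "uniformly_convex Z \<longleftrightarrow> (\<forall>\<epsilon>>0. \<exists>\<delta>>0. \<forall>x\<in>Z. \<forall>y\<in>Z.
     norm x = 1 \<longrightarrow> norm y = 1 \<longrightarrow> norm (x - y) \<ge> \<epsilon> \<longrightarrow> norm ((x + y) /\<^sub>R 2) \<le> 1 - \<delta>)"


section \<open>Pointwise products of continuous functions\<close>

text \<open>
  The compact Hausdorff space \<open>K\<close> is the carrier of a type \<open>'k\<close> of class \<^class>\<open>t2_space\<close> whose
  universe is compact. Continuous functions on it are bounded, so \<open>C(K,X)\<close> with the supremum norm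
  is the type \<open>'k \<Rightarrow>\<^sub>C 'x\<close>.
\<close>

lemma continuous_on_scaleC:
  fixes f :: "'k::topological_space \<Rightarrow> complex" and g :: "'k \<Rightarrow> 'x::complex_normed_vector"
  assumes "continuous_on S f" "continuous_on S g"
  shows "continuous_on S (\<lambda>t. f t *\<^sub>C g t)"
proof -
  have scaleC_left: "scaleC a (x :: 'x) = Re a *\<^sub>R x + Im a *\<^sub>R (\<i> *\<^sub>C x)" for a x
  proof -
    have "a = complex_of_real (Re a) + complex_of_real (Im a) * \<i>"
      by (simp add: complex_eq_iff)
    then have "a *\<^sub>C x = (complex_of_real (Re a) + complex_of_real (Im a) * \<i>) *\<^sub>C x"
      by (rule arg_cong)
    also have "\<dots> = Re a *\<^sub>R x + Im a *\<^sub>R (\<i> *\<^sub>C x)"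
      by (simp only: scaleC_add_left scaleC_scaleC [symmetric] scaleC_of_real)
    finally show ?thesis .
  qed
  have "bounded_linear (\<lambda>x :: 'x. \<i> *\<^sub>C x)"
  proof (rule bounded_linear_intro [where K = 1])
    show "\<i> *\<^sub>C (r *\<^sub>R x) = r *\<^sub>R (\<i> *\<^sub>C x)" for r and x :: 'x
      by (metis scaleC_of_real scaleC_scaleC mult.commute)
  qed (simp_all add: scaleC_add_right norm_scaleC)
  then have "continuous_on S (\<lambda>t. \<i> *\<^sub>C g t)"
    using assms(2) by (rule bounded_linear.continuous_on)
  then show ?thesis
    using assms by (subst scaleC_left) (intro continuous_intros)
qed

text \<open>
  For \<open>'x = complex\<close> this is the multiplication of \<open>C(K)\<close>; in general it is the action of \<open>C(K)\<close> on
  \<open>C(K,X)\<close>.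
\<close>
definition bc_mult ::
  "('k::topological_space \<Rightarrow>\<^sub>C complex) \<Rightarrow> ('k \<Rightarrow>\<^sub>C 'x::complex_normed_vector) \<Rightarrow> ('k \<Rightarrow>\<^sub>C 'x)"
  where "bc_mult g f = Bcontfun (\<lambda>t. apply_bcontfun g t *\<^sub>C apply_bcontfun f t)"

lemma apply_bc_mult: "apply_bcontfun (bc_mult g f) t = apply_bcontfun g t *\<^sub>C apply_bcontfun f t"
proof -
  have "norm (apply_bcontfun g t *\<^sub>C apply_bcontfun f t) \<le> norm g * norm f" for t
    unfolding norm_scaleC by (intro mult_mono norm_bounded) auto
  then have "(\<lambda>t. apply_bcontfun g t *\<^sub>C apply_bcontfun f t) \<in> bcontfun"
    by (auto simp: bcontfun_def bounded_iff intro!: continuous_on_scaleC)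
  then show ?thesis
    by (simp add: bc_mult_def Bcontfun_inverse)
qed

definition bc_tensor ::
  "('k::topological_space \<Rightarrow>\<^sub>C complex) \<Rightarrow> 'x::complex_normed_vector \<Rightarrow> ('k \<Rightarrow>\<^sub>C 'x)" where
  "bc_tensor f x = bc_mult f (const_bcontfun x)"

lemma apply_bc_tensor: "apply_bcontfun (bc_tensor f x) t = apply_bcontfun f t *\<^sub>C x"
  by (simp add: bc_tensor_def apply_bc_mult const_bcontfun.rep_eq)

instantiation bcontfun :: (topological_space, complex_normed_vector) complex_normed_vector
begin

definition scaleC_bcontfun :: "complex \<Rightarrow> ('a \<Rightarrow>\<^sub>C 'b) \<Rightarrow> ('a \<Rightarrow>\<^sub>C 'b)" where
  "scaleC_bcontfun c f = bc_mult (const_bcontfun c) f"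

lemma apply_scaleC_bcontfun:
  "apply_bcontfun (c *\<^sub>C f) t = c *\<^sub>C apply_bcontfun f t" for f :: "'a \<Rightarrow>\<^sub>C 'b"
  by (simp add: scaleC_bcontfun_def apply_bc_mult const_bcontfun.rep_eq)

instance
proof
  fix a b :: complex and r :: real and f g :: "'a \<Rightarrow>\<^sub>C 'b"
  show "a *\<^sub>C (f + g) = a *\<^sub>C f + a *\<^sub>C g"
    by (rule bcontfun_eqI) (simp add: apply_scaleC_bcontfun scaleC_add_right)
  show "(a + b) *\<^sub>C f = a *\<^sub>C f + b *\<^sub>C f"
    by (rule bcontfun_eqI) (simp add: apply_scaleC_bcontfun scaleC_add_left)
  show "a *\<^sub>C b *\<^sub>C f = (a * b) *\<^sub>C f"
    by (rule bcontfun_eqI) (simp add: apply_scaleC_bcontfun scaleC_scaleC)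
  show of_real: "complex_of_real r *\<^sub>C f = r *\<^sub>R f" for r and f :: "'a \<Rightarrow>\<^sub>C 'b"
    by (rule bcontfun_eqI) (simp add: apply_scaleC_bcontfun scaleC_of_real)
  have le: "norm (c *\<^sub>C h) \<le> cmod c * norm h" for c and h :: "'a \<Rightarrow>\<^sub>C 'b"
    by (rule norm_bound)
      (simp add: apply_scaleC_bcontfun norm_scaleC norm_bounded mult_left_mono)
  show "norm (a *\<^sub>C f) = cmod a * norm f"
  proof (cases "a = 0")
    case True
    then show ?thesis using le [of a f] by simp
  next
    case False
    have "inverse a *\<^sub>C a *\<^sub>C f = f"
      by (rule bcontfun_eqI)
        (use False scaleC_of_real [of 1] in \<open>simp add: apply_scaleC_bcontfun scaleC_scaleC\<close>)
    then have "norm f \<le> norm (a *\<^sub>C f) / cmod a"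
      using le [of "inverse a" "a *\<^sub>C f"] by (simp add: norm_inverse divide_inverse mult.commute)
    then show ?thesis
      using False le [of a f] by (simp add: field_simps)
  qed
qed

end


section \<open>Uniform algebras and function spaces\<close>

definition uniform_algebra :: "('k::topological_space \<Rightarrow>\<^sub>C complex) set \<Rightarrow> bool" where
  "uniform_algebra A \<longleftrightarrow>
     csubspace A \<and> (\<forall>f\<in>A. \<forall>g\<in>A. bc_mult f g \<in> A) \<and> closed A \<and>
     (\<forall>c. const_bcontfun c \<in> A) \<and>
     (\<forall>s t. s \<noteq> t \<longrightarrow> (\<exists>f\<in>A. apply_bcontfun f s \<noteq> apply_bcontfun f t))"

definition base_algebra ::
  "('k::topological_space \<Rightarrow>\<^sub>C 'x::complex_normed_vector) set \<Rightarrow> ('k \<Rightarrow>\<^sub>C complex) set" where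
  "base_algebra F =
     {g. \<exists>\<phi> f. dual_functional \<phi> \<and> f \<in> F \<and> apply_bcontfun g = \<phi> \<circ> apply_bcontfun f}"

text \<open>\<open>F\<close> is not required to be closed in \<open>C(K,X)\<close>; only its base algebra is.\<close>
definition function_space ::
  "('k::topological_space \<Rightarrow>\<^sub>C 'x::complex_normed_vector) set \<Rightarrow> ('k \<Rightarrow>\<^sub>C complex) set \<Rightarrow> bool" where
  "function_space F A \<longleftrightarrow>
     csubspace F \<and> A = base_algebra F \<and> uniform_algebra A \<and>
     {bc_tensor f x | f x. f \<in> A} \<subseteq> F \<and>
     (\<forall>g\<in>A. \<forall>f\<in>F. bc_mult g f \<in> F)"


section \<open>Boundaries\<close>

definition boundary_for :: "('k::topological_space \<Rightarrow>\<^sub>C complex) set \<Rightarrow> 'k set \<Rightarrow> bool" where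
  "boundary_for A L \<longleftrightarrow> (\<forall>f\<in>A. \<exists>t\<in>L. cmod (apply_bcontfun f t) = norm f)"

definition is_Shilov_boundary :: "('k::topological_space \<Rightarrow>\<^sub>C complex) set \<Rightarrow> 'k set \<Rightarrow> bool" where
  "is_Shilov_boundary A \<Gamma> \<longleftrightarrow>
     closed \<Gamma> \<and> boundary_for A \<Gamma> \<and> (\<forall>L. closed L \<and> boundary_for A L \<longrightarrow> \<Gamma> \<subseteq> L)"

text \<open>
  The bound \<open>r\<close> expresses that the supremum of \<open>\<bar>f\<bar>\<close> over \<open>K - U\<close> is less than 1, with the
  convention that this holds for \<open>U = K\<close> (\<^const>\<open>Sup\<close> of the empty set of reals is unspecified).
\<close>
definition Choquet_boundary :: "('k::topological_space \<Rightarrow>\<^sub>C complex) set \<Rightarrow> 'k set" where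
  "Choquet_boundary A =
     {x. \<forall>U. open U \<and> x \<in> U \<longrightarrow>
        (\<exists>f\<in>A. norm f = 1 \<and> cmod (apply_bcontfun f x) = 1 \<and>
           (\<exists>r<1. \<forall>t\<in>-U. cmod (apply_bcontfun f t) \<le> r))}"


section \<open>The convex diametral local diameter two property\<close>

text \<open>
  \<open>Z\<close> is a linear subspace of an ambient normed space, and closures are taken in \<open>Z\<close>. For
  \<open>\<Delta>\<close>-points the relative closure needs no mention because the point itself lies in \<open>Z\<close>.
\<close>

definition Delta_points :: "'a::real_normed_vector set \<Rightarrow> 'a set" where
  "Delta_points Z =
     {x \<in> Z. norm x = 1 \<and>
        (\<forall>\<epsilon>>0. x \<in> closure (convex hull {y \<in> Z. norm y \<le> 1 \<and> norm (x - y) \<ge> 2 - \<epsilon>}))}"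

definition convex_DLD2P :: "'a::real_normed_vector set \<Rightarrow> bool" where
  "convex_DLD2P Z \<longleftrightarrow> Z \<inter> closure (convex hull (Delta_points Z)) = {z \<in> Z. norm z \<le> 1}"

end

theory Submission
  imports Defs
begin

text \<open>
  Near a point \<open>x\<close> of the Choquet boundary, a series \<open>g = \<Sum>n. (1 - q) q\<^sup>n p\<^sub>n\<close> of ever more
  concentrated peak functions satisfies \<open>g x = 1\<close> and \<open>\<bar>g\<bar> + (1 - e) \<bar>1 - g\<bar> \<le> 1\<close> exactly. Hence, for
  \<open>f\<close> in the unit ball and \<open>f x\<close> written as a convex combination of unit vectors \<open>u\<close> and \<open>-u\<close>, the
  functions \<open>(1 - e) (1 - g) f + g \<otimes> (\<plusminus>u)\<close> stay in the unit ball, have norm 1 at \<open>x\<close>, and \<open>f\<close> is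
  close to their convex combination.

  A function \<open>f\<close> in the unit sphere with \<open>\<parallel>f x\<parallel> = 1\<close> at a limit point \<open>x\<close> of the Shilov boundary is a
  \<open>\<Delta>\<close>-point: take disjoint open sets \<open>U\<^sub>i\<close> close to \<open>x\<close> that meet the Shilov boundary, and \<open>g\<^sub>i\<close> in
  \<open>A\<close> close to 1 somewhere in \<open>U\<^sub>i\<close>, small on the Shilov boundary off \<open>U\<^sub>i\<close>, with
  \<open>\<bar>g\<^sub>i\<bar> + \<bar>1 - g\<^sub>i\<bar> \<le> 1 + e\<close>. The functions \<open>f - g\<^sub>i (f + f x)\<close> are nearly in the unit ball and nearly
  at distance 2 from \<open>f\<close>, and their averages converge to \<open>f\<close>. As the estimates on the \<open>g\<^sub>i\<close> pass
  from the Shilov boundary to \<open>K\<close> within \<open>A\<close>, no functionals on \<open>X\<close> are needed.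
\<close>

section \<open>Geometrically weighted sums\<close>

lemma sum_geometric_weights: "(\<Sum>i<n. (1 - q) * q ^ i) = 1 - q ^ n" for q :: "'a::comm_ring_1"
  by (induction n) (auto simp: algebra_simps)

lemma geometric_weights_sums: "(\<lambda>n. (1 - q) * q ^ n) sums 1" if "0 < q" "q < 1" for q :: real
  using sums_mult[OF geometric_sums[of q], of "1 - q"] that by simp

text \<open>The weights from index \<open>k\<close> on add up to \<open>q ^ k\<close>. With
  \<open>k = 0\<close> this bounds the whole sum \<open>w\<close> by \<open>d\<close>.\<close>

lemma geometric_weights_tail:
  fixes z :: "nat \<Rightarrow> complex" and q d :: real
  assumes "(\<lambda>n. ((1 - q) * q ^ n) *\<^sub>R z n) sums w" "0 < q" "q < 1"
    and z: "\<And>n. n \<ge> k \<Longrightarrow> cmod (z n) \<le> d"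
  shows "cmod (w - (\<Sum>i<k. ((1 - q) * q ^ i) *\<^sub>R z i)) \<le> d * q ^ k"
proof -
  let ?f = "\<lambda>n. ((1 - q) * q ^ (n + k)) *\<^sub>R z (n + k)"
  have s: "?f sums (w - (\<Sum>i<k. ((1 - q) * q ^ i) *\<^sub>R z i))"
    using assms(1) by (subst sums_iff_shift) simp
  have le: "norm (?f n) \<le> (d * q ^ k) * ((1 - q) * q ^ n)" for n
    using mult_left_mono[OF z[of "n + k"], of "(1 - q) * q ^ (n + k)"] assms(2,3)
    by (simp add: power_add mult_ac abs_mult)
  have g: "(\<lambda>n. (d * q ^ k) * ((1 - q) * q ^ n)) sums (d * q ^ k)"
    using sums_mult[OF geometric_weights_sums[OF assms(2,3)]] by simp
  have "norm (suminf ?f) \<le> (\<Sum>n. (d * q ^ k) * ((1 - q) * q ^ n))"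
    by (rule norm_suminf_le[OF le sums_summable[OF g]])
  then show ?thesis
    using s g by (simp add: sums_iff)
qed

text \<open>A term can be large only while the partial sum is near \<open>1 - q ^ n\<close>, a point
  of the segment [0,1], on which |w| + |1 - w| = 1. After the last such index \<open>j\<close> the
  sum hardly moves, so \<open>w\<close> stays near \<open>1 - q ^ j\<close>. Apart from \<rho>, the
  error is a small multiple of \<open>q ^ j\<close>, and the factor \<open>1 - e\<close> saves
  \<open>e * q ^ j\<close>, which pays for it.\<close>

lemma geometric_weights_estimate:
  fixes z :: "nat \<Rightarrow> complex" and q \<delta> \<rho> e :: real
  defines "S \<equiv> \<lambda>n. \<Sum>i<n. ((1 - q) * q ^ i) *\<^sub>R z i"
  assumes w: "(\<lambda>n. ((1 - q) * q ^ n) *\<^sub>R z n) sums w"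
    and q: "0 < q" "q < 1" and pos: "0 \<le> \<delta>" "0 \<le> \<rho>" "0 \<le> e" "e \<le> 1"
    and z1: "\<And>n. cmod (z n) \<le> 1"
    and small: "\<And>n. cmod (S n - of_real (1 - q ^ n)) \<ge> \<delta> * q ^ n + \<rho> \<Longrightarrow> cmod (z n) \<le> \<delta>"
    and param: "2 * (1 - q) + 4 * \<delta> \<le> e"
  shows "cmod w + (1 - e) * cmod (1 - w) \<le> 1 + 2 * \<rho>"
proof -
  define B where "B = {n. cmod (S n - of_real (1 - q ^ n)) < \<delta> * q ^ n + \<rho>}"
  have w1: "cmod w \<le> 1"
    using geometric_weights_tail[OF w q, of 0 1] z1 by simp
  consider (inf) "infinite B" | (empty) "B = {}" | (fin) "finite B" "B \<noteq> {}" by blast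
  then show ?thesis
  proof cases
    \<comment> \<open>The targets \<open>1 - q ^ n\<close> tend to 1, so \<open>w\<close> is within
      \<open>\<rho>\<close> of 1.\<close>
    case inf
    have "S \<longlonglongrightarrow> w" using w by (simp add: sums_def S_def)
    moreover have "(\<lambda>n. q ^ n) \<longlonglongrightarrow> 0" using q by (intro LIMSEQ_realpow_zero) auto
    ultimately have lim: "(\<lambda>n. cmod (S n - of_real (1 - q ^ n)) - \<delta> * q ^ n)
        \<longlonglongrightarrow> cmod (w - of_real (1 - 0)) - \<delta> * 0"
      by (intro tendsto_norm tendsto_diff tendsto_of_real tendsto_const tendsto_mult)
    have "cmod (w - 1) \<le> \<rho>"
    proof (rule ccontr)
      assume "\<not> ?thesis"
      then have "\<forall>\<^sub>F n in sequentially. \<rho> < cmod (S n - of_real (1 - q ^ n)) - \<delta> * q ^ n"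
        using order_tendstoD(1)[OF lim] by simp
      then obtain N where N: "\<And>n. n \<ge> N \<Longrightarrow> \<rho> < cmod (S n - of_real (1 - q ^ n)) - \<delta> * q ^ n"
        by (auto simp: eventually_sequentially)
      have "B \<subseteq> {..<N}" using N by (force simp: B_def not_le)
      with inf show False using finite_subset by blast
    qed
    moreover have "(1 - e) * cmod (1 - w) \<le> 1 * cmod (1 - w)"
      using pos by (intro mult_right_mono) auto
    ultimately show ?thesis using w1 pos by (simp add: norm_minus_commute)
  next
    case empty
    then have "cmod (z n) \<le> \<delta>" for n using small[of n] by (auto simp: B_def not_less)
    then have "cmod w \<le> \<delta>" using geometric_weights_tail[OF w q, of 0 \<delta>] by simp
    moreover have "cmod (1 - w) \<le> 1 + cmod w" using norm_triangle_ineq4[of 1 w] by simp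
    ultimately have "(1 - e) * cmod (1 - w) \<le> (1 - e) * (1 + \<delta>)"
      using pos by (intro mult_left_mono) auto
    moreover have "(1 - e) * (1 + \<delta>) \<le> 1 - e + \<delta>"
      using pos by (simp add: algebra_simps)
    ultimately have "(1 - e) * cmod (1 - w) \<le> 1 - e + \<delta>" by (rule order_trans)
    with \<open>cmod w \<le> \<delta>\<close> have "cmod w + (1 - e) * cmod (1 - w) \<le> \<delta> + (1 - e + \<delta>)"
      by (rule add_mono)
    also have "\<dots> \<le> 1 + 2 * \<rho>" using pos param q by simp
    finally show ?thesis .
  next
    case fin
    define j where "j = Max B"
    have "j \<in> B" using fin by (simp add: j_def)
    have zj: "cmod (z n) \<le> \<delta>" if "n \<ge> Suc j" for n
    proof (rule ccontr)
      assume "\<not> ?thesis"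
      then have "n \<in> B" using small[of n] by (metis (lifting) B_def mem_Collect_eq not_le)
      then show False using that Max_ge[OF fin(1), of n] by (simp add: j_def)
    qed
    \<comment> \<open>The error consists of the defect of \<open>S j\<close>, the
      \<open>j\<close>-th term, which may be large, and all later terms. Twice \<open>E\<close> is
      \<open>2 * \<rho> + q ^ j * (2 * (1 - q) + 4 * \<delta>)\<close>, where \<open>param\<close>
      bounds the second summand by \<open>q ^ j * e\<close>.\<close>
    define E where "E = \<delta> * q ^ j + \<rho> + (1 - q) * q ^ j + \<delta> * q ^ j"
    have "cmod (w - S (Suc j)) \<le> \<delta> * q ^ Suc j"
      unfolding S_def by (rule geometric_weights_tail[OF w q zj])
    moreover have "\<delta> * q ^ Suc j \<le> \<delta> * q ^ j"
      using pos q by (intro mult_left_mono power_decreasing) auto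
    moreover have "cmod (S (Suc j) - S j) \<le> (1 - q) * q ^ j"
      using mult_left_mono[OF z1[of j], of "(1 - q) * q ^ j"] q by (simp add: S_def)
    moreover have "cmod (S j - of_real (1 - q ^ j)) < \<delta> * q ^ j + \<rho>"
      using \<open>j \<in> B\<close> by (simp add: B_def)
    moreover have "cmod (w - of_real (1 - q ^ j)) \<le>
        cmod (w - S (Suc j)) + cmod (S (Suc j) - S j) + cmod (S j - of_real (1 - q ^ j))"
      using dist_triangle[of w "of_real (1 - q ^ j)" "S j"] dist_triangle[of w "S j" "S (Suc j)"]
      unfolding dist_norm by linarith
    ultimately have E: "cmod (w - of_real (1 - q ^ j)) \<le> E" by (simp add: E_def)
    have qj: "0 < q ^ j" "q ^ j \<le> 1" using q by (auto intro: power_le_one)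
    have "cmod w \<le> cmod (w - of_real (1 - q ^ j)) + cmod (of_real (1 - q ^ j))"
      using norm_triangle_ineq[of "w - of_real (1 - q ^ j)" "of_real (1 - q ^ j)"] by simp
    then have a: "cmod w \<le> E + (1 - q ^ j)"
      using E qj unfolding norm_of_real by simp
    have "cmod (1 - w) \<le> cmod (of_real (1 - q ^ j) - w) + cmod (of_real (q ^ j))"
      using norm_triangle_ineq[of "of_real (1 - q ^ j) - w" "of_real (q ^ j)"] by simp
    then have "cmod (1 - w) \<le> E + q ^ j"
      using E qj unfolding norm_of_real by (simp add: norm_minus_commute)
    then have "(1 - e) * cmod (1 - w) \<le> (1 - e) * (E + q ^ j)"
      using pos by (intro mult_left_mono) auto
    moreover have "0 \<le> E" using pos q by (simp add: E_def)
    then have "(1 - e) * (E + q ^ j) \<le> E + (1 - e) * q ^ j"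
      using pos by (simp add: algebra_simps)
    moreover have "q ^ j * (2 * (1 - q) + 4 * \<delta>) \<le> q ^ j * e"
      using param qj by (intro mult_left_mono) auto
    ultimately show ?thesis using a by (simp add: E_def algebra_simps)
  qed
qed

section \<open>Uniform algebras\<close>

lemma scaleC_complex_eq [simp]: "a *\<^sub>C b = a * b" for a b :: complex
  by (simp add: scaleC_complex_def)

lemma csubspace_scaleR: "csubspace S \<Longrightarrow> x \<in> S \<Longrightarrow> r *\<^sub>R x \<in> S"
  by (metis csubspace_def scaleC_of_real)

lemma csubspace_diff: "csubspace S \<Longrightarrow> x \<in> S \<Longrightarrow> y \<in> S \<Longrightarrow> x - y \<in> S"
  using csubspace_scaleR[of S y "-1"] by (auto simp: csubspace_def)

lemma csubspace_sum: "csubspace S \<Longrightarrow> (\<And>i. i \<in> I \<Longrightarrow> f i \<in> S) \<Longrightarrow> sum f I \<in> S"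
  by (induction I rule: infinite_finite_induct) (auto simp: csubspace_def)

lemma apply_bcontfun_sum:
  "apply_bcontfun (sum f I) t = (\<Sum>i\<in>I. apply_bcontfun (f i) t)"
  by (induction I rule: infinite_finite_induct) auto

context
  fixes A :: "('k::topological_space \<Rightarrow>\<^sub>C complex) set"
  assumes A: "uniform_algebra A"
begin

lemma uniform_algebra_subspace: "csubspace A"
  using A by (simp add: uniform_algebra_def)

lemma uniform_algebra_const: "const_bcontfun c \<in> A"
  using A by (simp add: uniform_algebra_def)

section \<open>Powers and series of peak functions\<close>

lemma uniform_algebra_power:
  assumes "f \<in> A"
  shows "\<exists>h\<in>A. \<forall>t. apply_bcontfun h t = apply_bcontfun f t ^ m"
proof (induction m)
  case 0
  then show ?case using uniform_algebra_const[of 1] by (intro bexI[of _ "const_bcontfun 1"]) auto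
next
  case (Suc m)
  then obtain h where "h \<in> A" "\<forall>t. apply_bcontfun h t = apply_bcontfun f t ^ m" by blast
  then show ?case
    using assms A by (intro bexI[of _ "bc_mult f h"]) (auto simp: apply_bc_mult uniform_algebra_def)
qed

text \<open>After division by the value at \<open>t0\<close>, the modulus on \<open>T\<close> is at
  most some \<open>s < 1\<close>; a high power makes it small there and keeps the value 1 at
  \<open>t0\<close>.\<close>

lemma uniform_algebra_amplify_peak:
  assumes f: "f \<in> A" "norm f = M" "cmod (apply_bcontfun f t0) = M" "M > 0"
    and r: "r < M" "\<And>t. t \<in> T \<Longrightarrow> cmod (apply_bcontfun f t) \<le> r" and "\<delta> > 0"
  shows "\<exists>h\<in>A. (\<forall>t. cmod (apply_bcontfun h t) \<le> 1) \<and> apply_bcontfun h t0 = 1 \<and>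
    (\<forall>t\<in>T. cmod (apply_bcontfun h t) \<le> \<delta>)"
proof -
  \<comment> \<open>\<open>r\<close> may be negative when \<open>T\<close> is empty, hence the
    maximum with 0.\<close>
  define s where "s = max 0 r / M"
  have s: "0 \<le> s" "s < 1" using f r by (auto simp: s_def)
  obtain m where m: "s ^ m < \<delta>" using real_arch_pow_inv[OF \<open>\<delta> > 0\<close> s(2)] by blast
  define f' where "f' = inverse (apply_bcontfun f t0) *\<^sub>C f"
  have f': "apply_bcontfun f' t = apply_bcontfun f t / apply_bcontfun f t0" for t
    by (simp add: f'_def apply_scaleC_bcontfun field_simps)
  have "f' \<in> A" using f uniform_algebra_subspace by (simp add: f'_def csubspace_def)
  then obtain h where h: "h \<in> A" "\<And>t. apply_bcontfun h t = apply_bcontfun f' t ^ m"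
    using uniform_algebra_power by blast
  have "cmod (apply_bcontfun f' t) \<le> 1" for t
    using norm_bounded[of f t] f by (simp add: f' norm_divide)
  moreover have "cmod (apply_bcontfun f' t) \<le> s" if "t \<in> T" for t
    using r(2)[OF that] f by (simp add: f' norm_divide s_def divide_right_mono le_max_iff_disj)
  ultimately have "cmod (apply_bcontfun h t) \<le> 1" "t \<in> T \<Longrightarrow> cmod (apply_bcontfun h t) \<le> \<delta>" for t
    using s m power_mono[of "cmod (apply_bcontfun f' t)" s m]
    by (auto simp: h norm_power power_le_one intro: order_trans)
  moreover have "apply_bcontfun h t0 = 1" using f by (auto simp: h f')
  ultimately show ?thesis using h by blast
qed

text \<open>
  The \<open>n\<close>-th summand is taken small off the set where the \<open>n\<close>-th partial sum is close to its value
  \<open>1 - q ^ n\<close> at the peak.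
\<close>
lemma uniform_algebra_peak_series:
  fixes q :: real and r :: "nat \<Rightarrow> real"
  assumes q: "0 < q" "q < 1"
    and P: "\<And>W. P W \<in> A" "\<And>W t. cmod (apply_bcontfun (P W) t) \<le> 1"
  obtains p g where "g \<in> A"
    and "\<And>t. (\<lambda>n. ((1 - q) * q ^ n) *\<^sub>R apply_bcontfun (p n) t) sums apply_bcontfun g t"
    and "\<And>n. p n = P {t\<in>U. cmod ((\<Sum>i<n. ((1 - q) * q ^ i) *\<^sub>R apply_bcontfun (p i) t)
                        - of_real (1 - q ^ n)) < r n}"
proof -
  define W where "W s n = {t\<in>U. cmod (apply_bcontfun s t - of_real (1 - q ^ n)) < r n}" for s n
  \<comment> \<open>\<open>p n\<close> depends on the earlier summands only through their partial
    sum, so the recursion carries the partial sum.\<close>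
  define S where "S = rec_nat 0 (\<lambda>n s. s + ((1 - q) * q ^ n) *\<^sub>R P (W s n))"
  define p where "p n = P (W (S n) n)" for n
  have S_eq: "S n = (\<Sum>i<n. ((1 - q) * q ^ i) *\<^sub>R p i)" for n
    by (induction n) (auto simp: S_def p_def)
  have S: "apply_bcontfun (S n) t = (\<Sum>i<n. ((1 - q) * q ^ i) *\<^sub>R apply_bcontfun (p i) t)" for n t
    by (simp add: S_eq apply_bcontfun_sum)
  have SA: "S n \<in> A" for n
    unfolding S_eq
    by (intro csubspace_sum csubspace_scaleR uniform_algebra_subspace) (simp add: p_def P)
  have "uniform_limit UNIV (\<lambda>n t. \<Sum>i<n. ((1 - q) * q ^ i) *\<^sub>R apply_bcontfun (p i) t)
     (\<lambda>t. \<Sum>i. ((1 - q) * q ^ i) *\<^sub>R apply_bcontfun (p i) t) sequentially"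
  proof (rule Weierstrass_m_test)
    show "summable (\<lambda>n. (1 - q) * q ^ n)"
      using geometric_weights_sums[OF q] by (rule sums_summable)
    show "norm (((1 - q) * q ^ n) *\<^sub>R apply_bcontfun (p n) t) \<le> (1 - q) * q ^ n" for n t
      using mult_left_mono[OF P(2)[of "W (S n) n" t], of "(1 - q) * q ^ n"] q
      by (simp add: p_def)
  qed
  then have "uniform_limit UNIV (\<lambda>n. apply_bcontfun (S n))
     (\<lambda>t. \<Sum>i. ((1 - q) * q ^ i) *\<^sub>R apply_bcontfun (p i) t) sequentially"
    unfolding S[abs_def] .
  then obtain g where g: "S \<longlonglongrightarrow> g"
    by (rule uniform_limit_bcontfunE) auto
  show thesis
  proof
    show "g \<in> A"
      using A SA g closed_sequentially by (auto simp: uniform_algebra_def)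
    show "(\<lambda>n. ((1 - q) * q ^ n) *\<^sub>R apply_bcontfun (p n) t) sums apply_bcontfun g t" for t
      using tendsto_uniform_limitI[OF tendsto_bcontfun_uniform_limit[OF g]]
      by (simp add: sums_def S)
    show "p n = P {t\<in>U. cmod ((\<Sum>i<n. ((1 - q) * q ^ i) *\<^sub>R apply_bcontfun (p i) t)
                        - of_real (1 - q ^ n)) < r n}" for n
      using p_def[of n] unfolding W_def S .
  qed
qed

lemma open_partial_sum_near:
  assumes "open U"
  shows "open {t\<in>U. cmod ((\<Sum>i<n. c i *\<^sub>R apply_bcontfun (p i) t) - a) < (r::real)}"
proof -
  have "open {t. cmod ((\<Sum>i<n. c i *\<^sub>R apply_bcontfun (p i) t) - a) < r}"
    by (intro open_Collect_less continuous_intros) auto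
  from open_Int[OF assms this] show ?thesis by (simp add: Int_def)
qed

text \<open>All summands peak at the same point \<open>x\<close>, so the partial sums there equal
  \<open>1 - q ^ n\<close> exactly and the tolerance may shrink like
  \<open>\<delta> * q ^ n\<close>. This is the case \<open>\<rho> = 0\<close> of
  \<open>geometric_weights_estimate\<close>, whence the bound 1 without error.\<close>

lemma Choquet_point_peak:
  assumes x: "x \<in> Choquet_boundary A" "x \<in> U" "open U" and e: "0 < e" "e < 1"
  shows "\<exists>g\<in>A. apply_bcontfun g x = 1 \<and>
    (\<forall>t. cmod (apply_bcontfun g t) + (1 - e) * cmod (1 - apply_bcontfun g t) \<le> 1) \<and>
    (\<forall>t\<in>-U. cmod (apply_bcontfun g t) \<le> e)"
proof -
  \<comment> \<open>Chosen so that \<open>2 * (1 - q) + 4 * \<delta> = e\<close>.\<close>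
  define q where "q = 1 - e / 4"
  define \<delta> where "\<delta> = e / 8"
  have q: "0 < q" "q < 1" and \<delta>: "0 < \<delta>" using e by (auto simp: q_def \<delta>_def)
  \<comment> \<open>The zero function serves for sets that are not open or miss \<open>x\<close>;
    thus \<open>P\<close> is total, and the series can be formed before its sets are known to
    contain \<open>x\<close>.\<close>
  have "\<exists>p\<in>A. (\<forall>t. cmod (apply_bcontfun p t) \<le> 1) \<and>
    (open W \<longrightarrow> (x \<in> W \<longrightarrow> apply_bcontfun p x = 1) \<and> (\<forall>t\<in>-W. cmod (apply_bcontfun p t) \<le> \<delta>))" for W
  proof (cases "open W \<and> x \<in> W")
    case True
    then obtain f r where "f \<in> A" "norm f = 1" "cmod (apply_bcontfun f x) = 1" "r < 1"
        "\<And>t. t \<in> -W \<Longrightarrow> cmod (apply_bcontfun f t) \<le> r"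
      using x by (auto simp: Choquet_boundary_def)
    from uniform_algebra_amplify_peak[where T = "-W", OF this(1-3) _ this(4,5) \<delta>] show ?thesis
      by auto
  next
    case False
    then show ?thesis
      using uniform_algebra_subspace \<delta> by (intro bexI[of _ 0]) (auto simp: csubspace_def)
  qed
  then have "\<forall>W. \<exists>p. p \<in> A \<and> (\<forall>t. cmod (apply_bcontfun p t) \<le> 1) \<and>
    (open W \<longrightarrow> (x \<in> W \<longrightarrow> apply_bcontfun p x = 1) \<and> (\<forall>t\<in>-W. cmod (apply_bcontfun p t) \<le> \<delta>))"
    by blast
  from choice[OF this] obtain P where "\<forall>W. P W \<in> A \<and> (\<forall>t. cmod (apply_bcontfun (P W) t) \<le> 1) \<and>
    (open W \<longrightarrow> (x \<in> W \<longrightarrow> apply_bcontfun (P W) x = 1) \<and>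
      (\<forall>t\<in>-W. cmod (apply_bcontfun (P W) t) \<le> \<delta>))" ..
  then have P: "\<And>W. P W \<in> A" "\<And>W t. cmod (apply_bcontfun (P W) t) \<le> 1"
    "\<And>W. open W \<Longrightarrow> x \<in> W \<Longrightarrow> apply_bcontfun (P W) x = 1"
    "\<And>W t. open W \<Longrightarrow> t \<notin> W \<Longrightarrow> cmod (apply_bcontfun (P W) t) \<le> \<delta>"
    by blast+
  obtain p g where g: "g \<in> A"
    and sums: "\<And>t. (\<lambda>n. ((1 - q) * q ^ n) *\<^sub>R apply_bcontfun (p n) t) sums apply_bcontfun g t"
    and p: "\<And>n. p n = P {t\<in>U. cmod ((\<Sum>i<n. ((1 - q) * q ^ i) *\<^sub>R apply_bcontfun (p i) t)
                        - of_real (1 - q ^ n)) < \<delta> * q ^ n}"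
    by (rule uniform_algebra_peak_series[where P = P and U = U and r = "\<lambda>n. \<delta> * q ^ n", OF q P(1,2)])
      (rule that)
  note op = open_partial_sum_near[OF \<open>open U\<close>]
  have p1: "cmod (apply_bcontfun (p n) t) \<le> 1" for n t by (subst p) (rule P(2))
  have small: "cmod (apply_bcontfun (p n) t) \<le> \<delta>"
    if "\<not> (t \<in> U \<and> cmod ((\<Sum>i<n. ((1 - q) * q ^ i) *\<^sub>R apply_bcontfun (p i) t)
                        - of_real (1 - q ^ n)) < \<delta> * q ^ n)" for n t
    by (subst p, rule P(4)[OF op]) (use that in simp)
  \<comment> \<open>If the earlier summands are 1 at \<open>x\<close>, the partial sum hits its
    target there, so \<open>x\<close> lies in the \<open>n\<close>-th set.\<close>
  have px: "apply_bcontfun (p n) x = 1" for n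
  proof (induction n rule: less_induct)
    case (less n)
    have "(\<Sum>i<n. ((1 - q) * q ^ i) *\<^sub>R apply_bcontfun (p i) x) = (\<Sum>i<n. of_real ((1 - q) * q ^ i))"
      by (rule sum.cong) (auto simp: less scaleR_conv_of_real)
    also have "\<dots> = of_real (1 - q ^ n)"
      unfolding of_real_sum[symmetric] sum_geometric_weights ..
    finally show ?case
      using x \<delta> q by (subst p) (intro P(3)[OF op], simp)
  qed
  have "(\<lambda>n. of_real ((1 - q) * q ^ n)) sums (of_real 1 :: complex)"
    using geometric_weights_sums[OF q] by (subst sums_of_real_iff)
  then have "apply_bcontfun g x = 1"
    using sums[of x] by (simp add: px scaleR_conv_of_real sums_iff)
  moreover have "cmod (apply_bcontfun g t) + (1 - e) * cmod (1 - apply_bcontfun g t) \<le> 1" for t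
    using geometric_weights_estimate[OF sums q, of \<delta> 0 e t] small p1 \<delta> e
    by (simp add: q_def \<delta>_def not_less)
  moreover have "cmod (apply_bcontfun g t) \<le> e" if "t \<notin> U" for t
    using geometric_weights_tail[OF sums q, of 0 t \<delta>] small[of t] that \<delta> e
    by (simp add: \<delta>_def)
  ultimately show ?thesis using g by blast
qed

section \<open>Estimates and peaks on the Shilov boundary\<close>

lemma boundary_bound:
  assumes "boundary_for A \<Gamma>" "u \<in> A" "\<And>t. t \<in> \<Gamma> \<Longrightarrow> cmod (apply_bcontfun u t) \<le> c"
  shows "cmod (apply_bcontfun u t) \<le> c"
  using assms norm_bounded[of u t] by (metis boundary_for_def order_trans)

text \<open>
  For fixed \<open>t\<close>, some unimodular \<open>a\<close>, \<open>b\<close> turn the left-hand side into the modulus of the value at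
  \<open>t\<close> of \<open>a g + b (1 - g)\<close>, which lies in \<open>A\<close>.
\<close>
lemma boundary_bound_complementary:
  assumes "boundary_for A \<Gamma>" "g \<in> A"
    and le: "\<And>t. t \<in> \<Gamma> \<Longrightarrow> cmod (apply_bcontfun g t) + cmod (1 - apply_bcontfun g t) \<le> c"
  shows "cmod (apply_bcontfun g t) + cmod (1 - apply_bcontfun g t) \<le> c"
proof -
  have unit: "\<exists>a. cmod a = 1 \<and> a * z = of_real (cmod z)" for z
  proof (cases "z = 0")
    case True
    then show ?thesis by (intro exI[of _ 1]) auto
  next
    case False
    then show ?thesis
      by (intro exI[of _ "cnj z / of_real (cmod z)"])
        (use complex_norm_square[of z] in \<open>simp add: norm_divide field_simps power2_eq_square\<close>)
  qed
  obtain a where a: "cmod a = 1" "a * apply_bcontfun g t = of_real (cmod (apply_bcontfun g t))"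
    using unit by blast
  obtain b where b: "cmod b = 1"
    "b * (1 - apply_bcontfun g t) = of_real (cmod (1 - apply_bcontfun g t))"
    using unit by blast
  define u where "u = a *\<^sub>C g + b *\<^sub>C (const_bcontfun 1 - g)"
  have u: "apply_bcontfun u s = a * apply_bcontfun g s + b * (1 - apply_bcontfun g s)" for s
    by (simp add: u_def apply_scaleC_bcontfun)
  have "u \<in> A"
    using assms(2) uniform_algebra_const uniform_algebra_subspace
      csubspace_diff[OF uniform_algebra_subspace] by (simp add: u_def csubspace_def)
  moreover have "cmod (apply_bcontfun u s) \<le> c" if "s \<in> \<Gamma>" for s
    unfolding u by (rule order_trans[OF norm_triangle_ineq]) (simp add: norm_mult a b le that)
  ultimately have "cmod (apply_bcontfun u t) \<le> c"
    by (rule boundary_bound[OF assms(1)])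
  then show ?thesis
    unfolding u a b of_real_add[symmetric] norm_of_real by simp
qed

text \<open>By minimality of \<open>\<Gamma>\<close>, the closed set \<open>\<Gamma> - W\<close> is
  no boundary, so some \<open>f\<close> in \<open>A\<close> stays below its norm there, by
  compactness uniformly. It attains its norm on \<open>\<Gamma>\<close>, hence in \<open>W\<close>,
  and this peak is amplified.\<close>

lemma Shilov_boundary_peak:
  assumes K: "compact (UNIV :: 'k set)" and \<Gamma>: "is_Shilov_boundary A \<Gamma>"
    and W: "open W" "W \<inter> \<Gamma> \<noteq> {}" and "\<delta> > 0"
  shows "\<exists>h\<in>A. (\<forall>t. cmod (apply_bcontfun h t) \<le> 1) \<and> (\<exists>t\<in>W \<inter> \<Gamma>. apply_bcontfun h t = 1) \<and>
    (\<forall>t\<in>\<Gamma> - W. cmod (apply_bcontfun h t) \<le> \<delta>)"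
proof (cases "\<Gamma> - W = {}")
  case True
  then show ?thesis using W uniform_algebra_const[of 1]
    by (intro bexI[of _ "const_bcontfun 1"]) auto
next
  case False
  have cl: "closed (\<Gamma> - W)" using \<Gamma> W by (auto simp: is_Shilov_boundary_def)
  moreover have "\<not> \<Gamma> \<subseteq> \<Gamma> - W" using W by auto
  ultimately have "\<not> boundary_for A (\<Gamma> - W)" using \<Gamma> unfolding is_Shilov_boundary_def by blast
  then obtain f where f: "f \<in> A" "\<And>t. t \<in> \<Gamma> - W \<Longrightarrow> cmod (apply_bcontfun f t) \<noteq> norm f"
    by (auto simp: boundary_for_def)
  have lt: "cmod (apply_bcontfun f t) < norm f" if "t \<in> \<Gamma> - W" for t
    using f(2)[OF that] norm_bounded[of f t] by simp
  have "compact (\<Gamma> - W)" using compact_Int_closed[OF K cl] by simp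
  then obtain t1 where t1: "t1 \<in> \<Gamma> - W"
      "\<And>t. t \<in> \<Gamma> - W \<Longrightarrow> cmod (apply_bcontfun f t) \<le> cmod (apply_bcontfun f t1)"
    using continuous_attains_sup[of "\<Gamma> - W" "\<lambda>t. cmod (apply_bcontfun f t)"] False
    by (auto intro: continuous_intros)
  obtain t0 where t0: "t0 \<in> \<Gamma>" "cmod (apply_bcontfun f t0) = norm f"
    using \<Gamma> f(1) by (auto simp: is_Shilov_boundary_def boundary_for_def)
  have "0 < norm f" using lt[OF t1(1)] norm_ge_zero order_le_less_trans by blast
  moreover have "t0 \<in> W" using t0 f(2) by blast
  ultimately show ?thesis
    using uniform_algebra_amplify_peak[OF f(1) refl t0(2) _ lt[OF t1(1)] t1(2) \<open>\<delta> > 0\<close>] t0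
    by blast
qed

text \<open>The peak point now varies with the summand, so no single point need hit all targets
  exactly. The tolerance is therefore a constant \<open>d\<close>, which enters
  \<open>geometric_weights_estimate\<close> as \<open>\<rho>\<close> and leaves an error in the
  bounds.\<close>

lemma Shilov_point_peak:
  assumes K: "compact (UNIV :: 'k set)" and \<Gamma>: "is_Shilov_boundary A \<Gamma>"
    and U: "open U" "U \<inter> \<Gamma> \<noteq> {}" and e: "0 < e" "e < 1"
  shows "\<exists>g\<in>A. (\<exists>t\<in>U. cmod (1 - apply_bcontfun g t) \<le> e) \<and>
    (\<forall>t. cmod (apply_bcontfun g t) \<le> 1) \<and>
    (\<forall>t. cmod (apply_bcontfun g t) + cmod (1 - apply_bcontfun g t) \<le> 1 + e) \<and>
    (\<forall>t\<in>\<Gamma> - U. cmod (apply_bcontfun g t) \<le> e)"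
proof -
  \<comment> \<open>\<open>d\<close> plays the role of \<open>e\<close> in the parameter condition:
    \<open>2 * (1 - q) + 4 * \<delta> = d\<close>.\<close>
  define d where "d = e / 4"
  define q where "q = 1 - d / 4"
  define \<delta> where "\<delta> = d / 8"
  have d: "0 < d" "d < 1" using e by (auto simp: d_def)
  have q: "0 < q" "q < 1" and \<delta>: "0 < \<delta>" using d by (auto simp: q_def \<delta>_def)
  have bd: "boundary_for A \<Gamma>" using \<Gamma> by (simp add: is_Shilov_boundary_def)
  have "\<exists>p\<in>A. (\<forall>t. cmod (apply_bcontfun p t) \<le> 1) \<and>
    (open W \<longrightarrow> (W \<inter> \<Gamma> \<noteq> {} \<longrightarrow> (\<exists>t\<in>W \<inter> \<Gamma>. apply_bcontfun p t = 1)) \<and>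
      (\<forall>t\<in>\<Gamma> - W. cmod (apply_bcontfun p t) \<le> \<delta>))" for W
  proof (cases "open W \<and> W \<inter> \<Gamma> \<noteq> {}")
    case True
    then show ?thesis using Shilov_boundary_peak[OF K \<Gamma> _ _ \<delta>, of W] by auto
  next
    case False
    then show ?thesis
      using uniform_algebra_subspace \<delta> by (intro bexI[of _ 0]) (auto simp: csubspace_def)
  qed
  then have "\<forall>W. \<exists>p. p \<in> A \<and> (\<forall>t. cmod (apply_bcontfun p t) \<le> 1) \<and>
    (open W \<longrightarrow> (W \<inter> \<Gamma> \<noteq> {} \<longrightarrow> (\<exists>t\<in>W \<inter> \<Gamma>. apply_bcontfun p t = 1)) \<and>
      (\<forall>t\<in>\<Gamma> - W. cmod (apply_bcontfun p t) \<le> \<delta>))"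
    unfolding Bex_def by (rule allI)
  from choice[OF this] obtain P where
    "\<forall>W. P W \<in> A \<and> (\<forall>t. cmod (apply_bcontfun (P W) t) \<le> 1) \<and>
    (open W \<longrightarrow> (W \<inter> \<Gamma> \<noteq> {} \<longrightarrow> (\<exists>t\<in>W \<inter> \<Gamma>. apply_bcontfun (P W) t = 1)) \<and>
      (\<forall>t\<in>\<Gamma> - W. cmod (apply_bcontfun (P W) t) \<le> \<delta>))" ..
  then have P: "\<And>W. P W \<in> A" "\<And>W t. cmod (apply_bcontfun (P W) t) \<le> 1"
    "\<And>W. open W \<Longrightarrow> W \<inter> \<Gamma> \<noteq> {} \<Longrightarrow> \<exists>t\<in>W \<inter> \<Gamma>. apply_bcontfun (P W) t = 1"
    "\<And>W t. open W \<Longrightarrow> t \<in> \<Gamma> - W \<Longrightarrow> cmod (apply_bcontfun (P W) t) \<le> \<delta>"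
    by blast+
  obtain p g where g: "g \<in> A"
    and sums: "\<And>t. (\<lambda>n. ((1 - q) * q ^ n) *\<^sub>R apply_bcontfun (p n) t) sums apply_bcontfun g t"
    and p: "\<And>n. p n = P {t\<in>U. cmod ((\<Sum>i<n. ((1 - q) * q ^ i) *\<^sub>R apply_bcontfun (p i) t)
                        - of_real (1 - q ^ n)) < d}"
    by (rule uniform_algebra_peak_series[where P = P and U = U and r = "\<lambda>n. d", OF q P(1,2)])
      (rule that)
  note op = open_partial_sum_near[OF \<open>open U\<close>]
  have p1: "cmod (apply_bcontfun (p n) t) \<le> 1" for n t by (subst p) (rule P(2))
  have small: "cmod (apply_bcontfun (p n) t) \<le> \<delta>"
    if "\<not> (t \<in> U \<and> cmod ((\<Sum>i<n. ((1 - q) * q ^ i) *\<^sub>R apply_bcontfun (p i) t)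
                        - of_real (1 - q ^ n)) < d)" "t \<in> \<Gamma>" for n t
    by (subst p, rule P(4)[OF op]) (use that in simp)
  \<comment> \<open>The summand \<open>p n\<close> is 1 at some point of the current set. There both
    the partial sum and its target grow by \<open>(1 - q) * q ^ n\<close>, so the defect stays below
    \<open>d\<close>.\<close>
  have near: "\<exists>t\<in>U \<inter> \<Gamma>. cmod ((\<Sum>i<n. ((1 - q) * q ^ i) *\<^sub>R apply_bcontfun (p i) t)
                        - of_real (1 - q ^ n)) < d" for n
  proof (induction n)
    case 0
    then show ?case using U d by auto
  next
    case (Suc n)
    let ?W = "{t\<in>U. cmod ((\<Sum>i<n. ((1 - q) * q ^ i) *\<^sub>R apply_bcontfun (p i) t)
                        - of_real (1 - q ^ n)) < d}"
    have "?W \<inter> \<Gamma> \<noteq> {}" using Suc by blast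
    from P(3)[OF op this, folded p]
    obtain t where t: "t \<in> ?W \<inter> \<Gamma>" "apply_bcontfun (p n) t = 1" ..
    have eq: "(\<Sum>i<Suc n. ((1 - q) * q ^ i) *\<^sub>R apply_bcontfun (p i) t) - of_real (1 - q ^ Suc n)
        = (\<Sum>i<n. ((1 - q) * q ^ i) *\<^sub>R apply_bcontfun (p i) t) - of_real (1 - q ^ n)"
      using t(2) by (simp add: scaleR_conv_of_real algebra_simps)
    show ?case
      using t(1) by (intro bexI[of _ t]) (unfold eq, blast+)
  qed
  \<comment> \<open>Three errors below \<open>d\<close> separate \<open>g\<close> from 1: the
    distance of the target from 1, the defect of the partial sum and the tail.\<close>
  obtain m where m: "q ^ m < d" using real_arch_pow_inv[OF d(1) q(2)] by blast
  obtain t where t: "t \<in> U" "cmod ((\<Sum>i<m. ((1 - q) * q ^ i) *\<^sub>R apply_bcontfun (p i) t)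
                        - of_real (1 - q ^ m)) < d" (is "cmod (?S - _) < _")
    using near by blast
  have "cmod (apply_bcontfun g t - ?S) \<le> q ^ m"
    using geometric_weights_tail[OF sums q, of m t 1] p1 by simp
  moreover have "cmod (1 - apply_bcontfun g t) \<le> cmod (1 - of_real (1 - q ^ m))
      + cmod (?S - of_real (1 - q ^ m)) + cmod (apply_bcontfun g t - ?S)"
    using dist_triangle[of 1 "apply_bcontfun g t" "of_real (1 - q ^ m)"]
      dist_triangle[of "of_real (1 - q ^ m)" "apply_bcontfun g t" ?S]
      dist_commute[of "of_real (1 - q ^ m)" ?S] dist_commute[of "apply_bcontfun g t" ?S]
    unfolding dist_norm by linarith
  moreover have "cmod (1 - of_real (1 - q ^ m)) = q ^ m"
    using q by (simp add: norm_power)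
  ultimately have "cmod (1 - apply_bcontfun g t) \<le> e"
    using m t(2) d by (simp add: d_def)
  moreover have g1: "cmod (apply_bcontfun g t) \<le> 1" for t
    using geometric_weights_tail[OF sums q, of 0 t 1] p1 by simp
  moreover have "cmod (apply_bcontfun g t) \<le> e" if "t \<in> \<Gamma> - U" for t
    using geometric_weights_tail[OF sums q, of 0 t \<delta>] small[of t] that d
    by (simp add: \<delta>_def d_def)
  \<comment> \<open>The summands are known to be small off their sets only on
    \<open>\<Gamma>\<close>, so the estimate is made there and then carried over to K. Removing the
    factor \<open>1 - d\<close> costs \<open>2 * d\<close> besides the error
    \<open>2 * \<rho>\<close>, in total \<open>4 * d = e\<close>.\<close>
  moreover have "cmod (apply_bcontfun g s) + cmod (1 - apply_bcontfun g s) \<le> 1 + e" for s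
  proof (rule boundary_bound_complementary[OF bd g])
    fix t assume "t \<in> \<Gamma>"
    have "cmod (apply_bcontfun g t) + (1 - d) * cmod (1 - apply_bcontfun g t) \<le> 1 + 2 * d"
    proof (rule geometric_weights_estimate[OF sums q, of \<delta>])
      fix n assume "\<delta> * q ^ n + d \<le> cmod ((\<Sum>i<n. ((1 - q) * q ^ i) *\<^sub>R apply_bcontfun (p i) t)
                        - of_real (1 - q ^ n))"
      moreover have "0 < \<delta> * q ^ n" using \<delta> q by simp
      ultimately show "cmod (apply_bcontfun (p n) t) \<le> \<delta>" using small \<open>t \<in> \<Gamma>\<close> by force
    qed (use p1 d \<delta> in \<open>auto simp: q_def \<delta>_def\<close>)
    moreover have "d * cmod (1 - apply_bcontfun g t) \<le> d * 2"
      using norm_triangle_ineq4[of 1 "apply_bcontfun g t"] g1[of t] d by (intro mult_left_mono) auto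
    ultimately show "cmod (apply_bcontfun g t) + cmod (1 - apply_bcontfun g t) \<le> 1 + e"
      by (simp add: d_def algebra_simps)
  qed
  ultimately show ?thesis using g t(1) by blast
qed

end

section \<open>Function spaces\<close>

lemma scaleC_one [simp]: "1 *\<^sub>C v = v" for v :: "'x::complex_normed_vector"
  using scaleC_of_real[of 1 v] by simp

lemma scaleC_diff_left: "(a - b) *\<^sub>C v = a *\<^sub>C v - b *\<^sub>C v" for v :: "'x::complex_normed_vector"
  using scaleC_add_left[of "a - b" b v] by simp

lemma scaleC_diff_right: "a *\<^sub>C (u - v) = a *\<^sub>C u - a *\<^sub>C v" for v :: "'x::complex_normed_vector"
  using scaleC_add_right[of a "u - v" v] by simp

lemma scaleC_zero_left [simp]: "0 *\<^sub>C v = 0" for v :: "'x::complex_normed_vector"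
  using scaleC_of_real[of 0 v] by simp

lemma scaleC_sum_left: "(\<Sum>i\<in>I. f i *\<^sub>C v) = (\<Sum>i\<in>I. f i) *\<^sub>C v"
  for v :: "'x::complex_normed_vector"
  by (induction I rule: infinite_finite_induct) (auto simp: scaleC_add_left)

lemma scaleC_scaleR_right: "a *\<^sub>C (r *\<^sub>R v) = r *\<^sub>R (a *\<^sub>C v)"
  for v :: "'x::complex_normed_vector"
  by (metis scaleC_of_real scaleC_scaleC mult.commute)

lemma function_spaceD:
  assumes "function_space F A"
  shows "csubspace F" "uniform_algebra A"
    and "g \<in> A \<Longrightarrow> bc_tensor g v \<in> F" "g \<in> A \<Longrightarrow> f \<in> F \<Longrightarrow> bc_mult g f \<in> F"
  using assms by (auto simp: function_space_def)

text \<open>The constant 1 has the form \<open>\<phi> \<circ> f\<close>, so \<open>f\<close> has a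
  nonzero value. The vector supplies a direction when the function to be approximated vanishes at
  the peak point.\<close>

lemma function_space_nontrivial:
  fixes F :: "('k::topological_space \<Rightarrow>\<^sub>C 'x::complex_normed_vector) set"
  assumes "function_space F A"
  obtains w :: 'x where "w \<noteq> 0"
proof -
  have "const_bcontfun 1 \<in> base_algebra F"
    using assms uniform_algebra_const[of A 1] by (auto simp: function_space_def)
  then obtain \<phi> :: "'x \<Rightarrow> complex" and f :: "'k \<Rightarrow>\<^sub>C 'x" where \<phi>: "dual_functional \<phi>"
      "apply_bcontfun (const_bcontfun 1) = \<phi> \<circ> apply_bcontfun f"
    unfolding base_algebra_def by blast
  fix t :: 'k
  have "\<phi> (apply_bcontfun f t) = 1" using fun_cong[OF \<phi>(2), of t] by simp
  moreover have "\<phi> 0 = 0"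
    using \<phi>(1) linear_0[OF bounded_linear.linear] by (auto simp: dual_functional_def)
  ultimately have "apply_bcontfun f t \<noteq> 0" by (metis zero_neq_one)
  then show thesis by (rule that)
qed

text \<open>\<open>u\<close> is the direction of \<open>y\<close>, or of \<open>w\<close> if
  \<open>y = 0\<close>; the weight \<open>l = (1 + norm y) / 2\<close> then gives
  \<open>y\<close>.\<close>

lemma convex_combination_antipodal_unit:
  fixes y w :: "'a::real_normed_vector"
  assumes "w \<noteq> 0" "norm y \<le> 1"
  obtains u l where "norm u = 1" "0 \<le> l" "l \<le> 1" "y = l *\<^sub>R u + (1 - l) *\<^sub>R (- u)"
proof -
  obtain u where u: "norm u = 1" "y = norm y *\<^sub>R u"
  proof (cases "y = 0")
    case True
    then show ?thesis using assms that[of "w /\<^sub>R norm w"] by simp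
  next
    case False
    then show ?thesis using that[of "y /\<^sub>R norm y"] by simp
  qed
  define l where "l = (1 + norm y) / 2"
  have "l *\<^sub>R u + (1 - l) *\<^sub>R (- u) = (2 * l - 1) *\<^sub>R u"
    by (simp add: algebra_simps flip: scaleR_add_left)
  also have "2 * l - 1 = norm y" by (simp add: l_def field_simps)
  also have "norm y *\<^sub>R u = y" by (rule u(2)[symmetric])
  finally show thesis
    using u assms by (intro that[of u l]) (auto simp: l_def)
qed

text \<open>Separate a point of \<open>S\<close> in \<open>V\<close> from \<open>x\<close>. The
  neighbourhood of that point becomes one member, and the induction goes on inside the neighbourhood
  of \<open>x\<close>; this is why \<open>V\<close> is arbitrary.\<close>

lemma islimpt_disjoint_open_family:
  fixes x :: "'a::t2_space"
  assumes "x islimpt S" "open V" "x \<in> V"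
  shows "\<exists>U. \<forall>i<n::nat. open (U i) \<and> U i \<subseteq> V \<and> U i \<inter> S \<noteq> {} \<and> (\<forall>j<i. U i \<inter> U j = {})"
  using assms(2,3)
proof (induction n arbitrary: V)
  case 0
  then show ?case by simp
next
  case (Suc n)
  obtain t where t: "t \<in> S" "t \<in> V" "t \<noteq> x"
    using islimptE[OF assms(1)] Suc.prems by metis
  obtain B C where BC: "open B" "open C" "t \<in> B" "x \<in> C" "B \<inter> C = {}"
    using hausdorff[OF t(3)] by blast
  have "\<exists>U. \<forall>i<n. open (U i) \<and> U i \<subseteq> V \<inter> C \<and> U i \<inter> S \<noteq> {} \<and> (\<forall>j<i. U i \<inter> U j = {})"
    by (rule Suc.IH) (use Suc.prems BC in auto)
  then obtain U where
    U: "\<forall>i<n. open (U i) \<and> U i \<subseteq> V \<inter> C \<and> U i \<inter> S \<noteq> {} \<and> (\<forall>j<i. U i \<inter> U j = {})" ..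
  have "V \<inter> B \<inter> U j = {}" if "j < n" for j using U BC that by blast
  then show ?case
    using U BC t Suc.prems by (intro exI[of _ "U(n := V \<inter> B)"]) (auto simp: less_Suc_eq)
qed

section \<open>Delta-points from limit points of the Shilov boundary\<close>

lemma norm_one_at_limit_point_Delta:
  fixes F :: "('k::t2_space \<Rightarrow>\<^sub>C 'x::complex_normed_vector) set"
  assumes K: "compact (UNIV :: 'k set)" and F: "function_space F A"
    and \<Gamma>: "is_Shilov_boundary A \<Gamma>" and x: "x islimpt \<Gamma>"
    and f: "f \<in> F" "norm f = 1" "norm (apply_bcontfun f x) = 1"
  shows "f \<in> Delta_points F"
proof -
  note FA = function_spaceD[OF F]
  have bd: "boundary_for A \<Gamma>" using \<Gamma> by (simp add: is_Shilov_boundary_def)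
  define y where "y = apply_bcontfun f x"
  have y: "norm y = 1" using f by (simp add: y_def)
  have f1: "norm (apply_bcontfun f t) \<le> 1" for t using norm_bounded[of f t] f by simp
  have "\<exists>k\<in>convex hull {h \<in> F. norm h \<le> 1 \<and> norm (f - h) \<ge> 2 - \<epsilon>}. dist k f < \<eta>"
    if "\<epsilon> > 0" "\<eta> > 0" for \<epsilon> \<eta> :: real
  proof -
    \<comment> \<open>The distance from \<open>f\<close> will fall short of 2 by at most
      \<open>4 * e\<close>, and the average will be within \<open>3 * e + 2 / real n\<close> of
      \<open>f\<close>.\<close>
    define e where "e = min (1/2) (min (\<epsilon> / 4) (\<eta> / 8))"
    have e: "0 < e" "e < 1" "4 * e \<le> \<epsilon>" "8 * e \<le> \<eta>" using that by (auto simp: e_def min_def)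
    obtain n where n': "4 / \<eta> < real n" using reals_Archimedean2 by blast
    moreover have "0 < 4 / \<eta>" using that by simp
    ultimately have "0 < real n" by linarith
    then have n: "0 < n" "2 / real n < \<eta> / 2" using n' that by (auto simp: field_simps)
    define V where "V = {t. dist (apply_bcontfun f t) y < e}"
    have V: "open V" "x \<in> V"
      using e by (auto simp: V_def y_def intro!: open_Collect_less continuous_intros)
    obtain U where U: "\<And>i. i < n \<Longrightarrow> open (U i)" "\<And>i. i < n \<Longrightarrow> U i \<subseteq> V"
      "\<And>i. i < n \<Longrightarrow> U i \<inter> \<Gamma> \<noteq> {}" "\<And>i j. i < n \<Longrightarrow> j < i \<Longrightarrow> U i \<inter> U j = {}"
      using islimpt_disjoint_open_family[OF x V, of n] by blast
    have "\<forall>i. \<exists>g. i < n \<longrightarrow> g \<in> A \<and> (\<exists>t\<in>U i. cmod (1 - apply_bcontfun g t) \<le> e) \<and>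
      (\<forall>t. cmod (apply_bcontfun g t) \<le> 1) \<and>
      (\<forall>t. cmod (apply_bcontfun g t) + cmod (1 - apply_bcontfun g t) \<le> 1 + e) \<and>
      (\<forall>t\<in>\<Gamma> - U i. cmod (apply_bcontfun g t) \<le> e)"
      using Shilov_point_peak[OF FA(2) K \<Gamma> U(1,3) e(1,2)] by blast
    from choice[OF this] obtain G where G: "\<And>i. i < n \<Longrightarrow> G i \<in> A"
      "\<And>i. i < n \<Longrightarrow> \<exists>t\<in>U i. cmod (1 - apply_bcontfun (G i) t) \<le> e"
      "\<And>i t. i < n \<Longrightarrow> cmod (apply_bcontfun (G i) t) \<le> 1"
      "\<And>i t. i < n \<Longrightarrow> cmod (apply_bcontfun (G i) t) + cmod (1 - apply_bcontfun (G i) t) \<le> 1 + e"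
      "\<And>i t. i < n \<Longrightarrow> t \<in> \<Gamma> - U i \<Longrightarrow> cmod (apply_bcontfun (G i) t) \<le> e"
      by blast
    \<comment> \<open>Division by \<open>1 + e\<close> puts the function into the unit ball exactly;
      \<open>u i\<close> is its value before the division.\<close>
    define h where "h i = (1 / (1 + e)) *\<^sub>R (f - (bc_mult (G i) f + bc_tensor (G i) y))" for i
    define u where "u i t = (1 - apply_bcontfun (G i) t) *\<^sub>C apply_bcontfun f t
      - apply_bcontfun (G i) t *\<^sub>C y" for i t
    have h: "apply_bcontfun (h i) t = (1 / (1 + e)) *\<^sub>R u i t" for i t
      by (simp add: h_def u_def apply_bc_mult apply_bc_tensor scaleC_diff_left)
    have u: "norm (u i t) \<le> 1 + e" if "i < n" for i t
    proof -
      have "norm (u i t) \<le> cmod (1 - apply_bcontfun (G i) t) * norm (apply_bcontfun f t)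
          + cmod (apply_bcontfun (G i) t) * norm y"
        unfolding u_def norm_scaleC[symmetric] by (rule norm_triangle_ineq4)
      also have "\<dots> \<le> cmod (1 - apply_bcontfun (G i) t) * 1 + cmod (apply_bcontfun (G i) t) * 1"
        using f1 y by (intro add_mono mult_left_mono) auto
      also have "\<dots> \<le> 1 + e" using G(4)[OF that, of t] by simp
      finally show ?thesis .
    qed
    have "h i \<in> {h \<in> F. norm h \<le> 1 \<and> norm (f - h) \<ge> 2 - \<epsilon>}" if i: "i < n" for i
    proof -
      have "h i \<in> F"
        unfolding h_def using FA f(1) G(1)[OF i]
        by (intro csubspace_scaleR csubspace_diff) (auto simp: csubspace_def)
      moreover have "norm (h i) \<le> 1"
        using u[OF i] e by (intro norm_bound) (simp add: h field_simps)
      moreover have "2 - \<epsilon> \<le> norm (f - h i)"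
      proof -
        \<comment> \<open>Where \<open>G i\<close> is near 1, \<open>u i t\<close> is near
          \<open>- y\<close> while \<open>f\<close> is near \<open>y\<close>, so they differ by
          nearly \<open>2 *\<^sub>R y\<close>.\<close>
        obtain t where t: "t \<in> U i" "cmod (1 - apply_bcontfun (G i) t) \<le> e" using G(2)[OF i] by blast
        let ?v = "apply_bcontfun f t"
        have "t \<in> V" using t U(2)[OF i] by blast
        then have v: "norm (?v - y) < e" by (simp add: V_def dist_norm)
        have "u i t + y = (1 - apply_bcontfun (G i) t) *\<^sub>C (?v + y)"
          by (simp add: u_def scaleC_diff_left scaleC_add_right)
        then have "norm (u i t + y) \<le> e * 2"
          using norm_triangle_ineq[of ?v y] f1[of t] y t(2) e
          unfolding norm_scaleC by (simp add: norm_scaleC) (intro mult_mono, auto)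
        moreover have "norm ((e / (1 + e)) *\<^sub>R u i t) \<le> e"
          using u[OF i, of t] e mult_left_mono[OF u[OF i, of t], of e] by (simp add: field_simps)
        moreover have "2 *\<^sub>R y = (?v - (1 / (1 + e)) *\<^sub>R u i t) - (?v - y) + (u i t + y)
            - (e / (1 + e)) *\<^sub>R u i t"
        proof -
          have "(1 / (1 + e)) *\<^sub>R u i t + (e / (1 + e)) *\<^sub>R u i t = u i t"
            using e by (simp add: field_simps flip: scaleR_add_left)
          then show ?thesis by (simp add: scaleR_2 algebra_simps)
        qed
        then have "norm (2 *\<^sub>R y) \<le> norm (?v - (1 / (1 + e)) *\<^sub>R u i t) + norm (?v - y)
            + norm (u i t + y) + norm ((e / (1 + e)) *\<^sub>R u i t)"
          by (simp only:) (rule norm_triangle_ineq4[THEN order_trans] norm_triangle_ineq[THEN order_trans]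
              add_right_mono norm_triangle_ineq4)+
        ultimately have "2 - 4 * e \<le> norm (?v - (1 / (1 + e)) *\<^sub>R u i t)"
          using v y by simp
        also have "\<dots> \<le> norm (f - h i)"
          using norm_bounded[of "f - h i" t] by (simp add: h)
        finally show ?thesis using e by simp
      qed
      ultimately show ?thesis by simp
    qed
    then have "(\<Sum>i<n. (1 / real n) *\<^sub>R h i) \<in> convex hull {h \<in> F. norm h \<le> 1 \<and> norm (f - h) \<ge> 2 - \<epsilon>}"
      using n by (intro convex_sum convex_convex_hull) (auto intro: hull_inc)
    moreover have "dist (\<Sum>i<n. (1 / real n) *\<^sub>R h i) f < \<eta>"
    proof -
      \<comment> \<open>At a point of \<open>\<Gamma>\<close>, disjointness of the
        \<open>U i\<close> leaves at most one \<open>G i\<close> that may exceed \<open>e\<close> in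
        modulus. So the sum is at most \<open>1 + real n * e\<close>, and being in \<open>A\<close>
        it obeys this bound on all of K.\<close>
      have gA: "(\<Sum>i<n. G i) \<in> A"
        using G(1) by (intro csubspace_sum uniform_algebra_subspace FA) auto
      have "norm (apply_bcontfun (\<Sum>i<n. G i) t) \<le> 1 + real n * e" if "t \<in> \<Gamma>" for t
      proof -
        have "cmod (apply_bcontfun (G i) t) \<le> (if t \<in> U i then 1 else 0) + e" if "i < n" for i
          using G(3,5)[OF that, of t] \<open>t \<in> \<Gamma>\<close> e by auto
        then have "(\<Sum>i<n. cmod (apply_bcontfun (G i) t)) \<le> (\<Sum>i<n. (if t \<in> U i then 1 else 0) + e)"
          by (intro sum_mono) auto
        also have "\<dots> = real (card {i\<in>{..<n}. t \<in> U i}) + real n * e"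
          by (simp add: sum.distrib sum.If_cases Int_def)
        also have "card {i\<in>{..<n}. t \<in> U i} \<le> 1"
          using U(4) by (intro card_le_Suc0_iff_eq[THEN iffD2, folded One_nat_def])
            (auto, metis disjoint_iff linorder_neqE_nat)
        finally show ?thesis
          using norm_sum[of "\<lambda>i. apply_bcontfun (G i) t" "{..<n}"] by (simp add: apply_bcontfun_sum)
      qed
      then have s: "cmod (apply_bcontfun (\<Sum>i<n. G i) t) \<le> 1 + real n * e" for t
        by (rule boundary_bound[OF FA(2) bd gA])
      have "norm (apply_bcontfun ((\<Sum>i<n. (1 / real n) *\<^sub>R h i) - f) t) \<le> 3 * e + 2 / real n" for t
      proof -
        define v where "v = apply_bcontfun f t"
        define a where "a = apply_bcontfun (\<Sum>i<n. G i) t"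
        have a: "a = (\<Sum>i<n. apply_bcontfun (G i) t)" by (simp add: a_def apply_bcontfun_sum)
        \<comment> \<open>In the average the perturbation is \<open>a *\<^sub>C (v + y)\<close>
          divided by \<open>n\<close>, hence of order \<open>e + 1 / real n\<close>.\<close>
        have "(\<Sum>i<n. u i t) = real n *\<^sub>R v - a *\<^sub>C (v + y)"
          unfolding u_def v_def[symmetric] a
          by (simp add: scaleC_diff_left sum_subtractf scaleC_sum_left scaleC_add_right
              sum_constant_scaleR)
        then have "apply_bcontfun (\<Sum>i<n. (1 / real n) *\<^sub>R h i) t =
            (1 / (1 + e)) *\<^sub>R (v - (1 / real n) *\<^sub>R (a *\<^sub>C (v + y)))"
          using n by (simp add: apply_bcontfun_sum h scaleR_right_diff_distrib mult.commute
              flip: scaleR_sum_right)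
        then have "apply_bcontfun ((\<Sum>i<n. (1 / real n) *\<^sub>R h i) - f) t =
            (1 / (1 + e)) *\<^sub>R (v - (1 / real n) *\<^sub>R (a *\<^sub>C (v + y)) - (1 + e) *\<^sub>R v)"
          using e by (simp add: v_def scaleR_right_diff_distrib)
        also have "\<dots> = (1 / (1 + e)) *\<^sub>R (- (e *\<^sub>R v) - (1 / real n) *\<^sub>R (a *\<^sub>C (v + y)))"
          by (simp add: algebra_simps)
        also have "norm \<dots> \<le> norm (- (e *\<^sub>R v) - (1 / real n) *\<^sub>R (a *\<^sub>C (v + y)))"
          unfolding norm_scaleR using e by (intro mult_left_le_one_le) auto
        also have "\<dots> \<le> e * norm v + (1 / real n) * (cmod a * norm (v + y))"
          using norm_triangle_ineq4[of "- (e *\<^sub>R v)" "(1 / real n) *\<^sub>R (a *\<^sub>C (v + y))"] e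
          by (simp add: norm_scaleC)
        also have "\<dots> \<le> e * 1 + (1 / real n) * ((1 + real n * e) * 2)"
          using e f1[of t] s[of t] y norm_triangle_ineq[of v y]
          by (intro add_mono mult_left_mono mult_mono) (auto simp: v_def a_def)
        also have "\<dots> = 3 * e + 2 / real n" using n by (simp add: field_simps)
        finally show ?thesis .
      qed
      then have "norm ((\<Sum>i<n. (1 / real n) *\<^sub>R h i) - f) \<le> 3 * e + 2 / real n"
        by (rule norm_bound)
      then show ?thesis using n e that by (simp add: dist_norm)
    qed
    ultimately show ?thesis by blast
  qed
  then show ?thesis
    using f by (auto simp: Delta_points_def closure_approachable)
qed

section \<open>Approximation of the unit ball by convex combinations of Delta-points\<close>

lemma unit_ball_approx_Delta:
  fixes F :: "('k::t2_space \<Rightarrow>\<^sub>C 'x::complex_normed_vector) set"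
  assumes K: "compact (UNIV :: 'k set)" and F: "function_space F A"
    and \<Gamma>: "is_Shilov_boundary A \<Gamma>" and x: "x islimpt \<Gamma>" "x \<in> Choquet_boundary A"
    and f: "f \<in> F" "norm f \<le> 1"
  shows "f \<in> closure (convex hull (Delta_points F))"
  unfolding closure_approachable
proof (intro allI impI)
  fix \<eta> :: real assume "0 < \<eta>"
  note FA = function_spaceD[OF F]
  define e where "e = min (1/2) (\<eta> / 8)"
  have e: "0 < e" "e < 1" "8 * e \<le> \<eta>" using \<open>0 < \<eta>\<close> by (auto simp: e_def min_def)
  have f1: "norm (apply_bcontfun f t) \<le> 1" for t using norm_bounded[of f t] f by simp
  define y where "y = apply_bcontfun f x"
  obtain w :: 'x where "w \<noteq> 0" using function_space_nontrivial[OF F] .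
  then obtain u l where u: "norm u = 1" and l: "0 \<le> l" "l \<le> 1"
    and y: "y = l *\<^sub>R u + (1 - l) *\<^sub>R (- u)"
    using convex_combination_antipodal_unit[of w y] f1 by (auto simp: y_def)
  define U where "U = {t. dist (apply_bcontfun f t) y < e}"
  have "open U" "x \<in> U"
    using e by (auto simp: U_def y_def intro!: open_Collect_less continuous_intros)
  then obtain g where g: "g \<in> A" "apply_bcontfun g x = 1"
    "\<And>t. cmod (apply_bcontfun g t) + (1 - e) * cmod (1 - apply_bcontfun g t) \<le> 1"
    "\<And>t. t \<in> -U \<Longrightarrow> cmod (apply_bcontfun g t) \<le> e"
    using Choquet_point_peak[OF FA(2) x(2) _ _ e(1,2), of U] by blast
  \<comment> \<open>\<open>k v\<close> takes the value \<open>v\<close> at \<open>x\<close>, and the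
    inequality for \<open>g\<close> keeps it in the unit ball. As \<open>k\<close> is affine in
    \<open>v\<close>, the combination of \<open>k u\<close> and \<open>k (- u)\<close> is
    \<open>k y\<close>.\<close>
  define k where "k v = (1 - e) *\<^sub>R (f - bc_mult g f) + bc_tensor g v" for v
  have k: "apply_bcontfun (k v) t = (1 - e) *\<^sub>R ((1 - apply_bcontfun g t) *\<^sub>C apply_bcontfun f t)
      + apply_bcontfun g t *\<^sub>C v" for v t
    by (simp add: k_def apply_bc_mult apply_bc_tensor scaleC_diff_left)
  have kD: "k v \<in> Delta_points F" if v: "norm v = 1" for v
  proof (rule norm_one_at_limit_point_Delta[OF K F \<Gamma> x(1)])
    have "(1 - e) *\<^sub>R (f - bc_mult g f) \<in> F"
      using FA f(1) g(1) by (intro csubspace_scaleR csubspace_diff) auto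
    then show "k v \<in> F"
      using FA(1) FA(3)[OF g(1)] by (simp add: k_def csubspace_def)
    show kx: "norm (apply_bcontfun (k v) x) = 1" by (simp add: k g v)
    have "norm (apply_bcontfun (k v) t) \<le> 1" for t
    proof -
      have "norm (apply_bcontfun (k v) t) \<le>
          (1 - e) * (cmod (1 - apply_bcontfun g t) * norm (apply_bcontfun f t))
          + cmod (apply_bcontfun g t) * norm v"
        unfolding k using e by (intro norm_triangle_le) (simp add: norm_scaleC)
      also have "\<dots> \<le> (1 - e) * (cmod (1 - apply_bcontfun g t) * 1) + cmod (apply_bcontfun g t) * 1"
        using e f1 v by (intro add_mono mult_left_mono) auto
      also have "\<dots> \<le> 1" using g(3)[of t] by simp
      finally show ?thesis .
    qed
    then have "norm (k v) \<le> 1" by (rule norm_bound)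
    then show "norm (k v) = 1" using norm_bounded[of "k v" x] kx by simp
  qed
  have "l *\<^sub>R k u + (1 - l) *\<^sub>R k (- u) \<in> convex hull (Delta_points F)"
    using kD u l by (intro convexD[OF convex_convex_hull] hull_inc) auto
  moreover have "dist (l *\<^sub>R k u + (1 - l) *\<^sub>R k (- u)) f < \<eta>"
  proof -
    have "norm (apply_bcontfun (l *\<^sub>R k u + (1 - l) *\<^sub>R k (- u) - f) t) \<le> 4 * e" for t
    proof -
      define b where "b = apply_bcontfun g t"
      define v where "v = apply_bcontfun f t"
      have "l *\<^sub>R (b *\<^sub>C u) + (1 - l) *\<^sub>R (b *\<^sub>C (- u)) = b *\<^sub>C y"
        unfolding y by (simp add: scaleC_add_right scaleC_scaleR_right del: scaleR_minus_right)
      moreover have "l *\<^sub>R z + (1 - l) *\<^sub>R z = z" for z :: 'x by (simp add: algebra_simps)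
      ultimately have "l *\<^sub>R (z + b *\<^sub>C u) + (1 - l) *\<^sub>R (z + b *\<^sub>C (- u)) = z + b *\<^sub>C y" for z
        by (simp add: scaleR_add_right add_ac)
      then have "apply_bcontfun (l *\<^sub>R k u + (1 - l) *\<^sub>R k (- u) - f) t =
          (1 - e) *\<^sub>R ((1 - b) *\<^sub>C v) + b *\<^sub>C y - v"
        by (simp add: k b_def v_def)
      also have "\<dots> = b *\<^sub>C (y - v) - e *\<^sub>R ((1 - b) *\<^sub>C v)"
        by (simp add: scaleC_diff_left scaleC_diff_right algebra_simps)
      also have "norm \<dots> \<le> cmod b * norm (y - v) + e * (cmod (1 - b) * norm v)"
        using norm_triangle_ineq4[of "b *\<^sub>C (y - v)" "e *\<^sub>R ((1 - b) *\<^sub>C v)"] e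
        by (simp add: norm_scaleC)
      also have "\<dots> \<le> 2 * e + e * (2 * 1)"
      proof (rule add_mono)
        have "0 \<le> (1 - e) * cmod (1 - b)" using e by simp
        then have b1: "cmod b \<le> 1" using g(3)[of t] by (simp add: b_def)
        then have "cmod (1 - b) \<le> 2" using norm_triangle_ineq4[of 1 b] by simp
        then show "e * (cmod (1 - b) * norm v) \<le> e * (2 * 1)"
          using e f1[of t] by (intro mult_left_mono mult_mono) (auto simp: v_def)
        show "cmod b * norm (y - v) \<le> 2 * e"
        \<comment> \<open>On \<open>U\<close>, \<open>f\<close> is near its value \<open>y\<close>
          at \<open>x\<close>; off \<open>U\<close>, \<open>g\<close> is small.\<close>
        proof (cases "t \<in> U")
          case True
          then have "norm (y - v) \<le> e" by (simp add: U_def v_def dist_norm norm_minus_commute)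
          then have "cmod b * norm (y - v) \<le> 1 * e" using b1 e by (intro mult_mono) auto
          then show ?thesis using e by simp
        next
          case False
          then have "cmod b \<le> e" using g(4)[of t] by (simp add: b_def)
          moreover have "norm (y - v) \<le> 2"
            using norm_triangle_ineq4[of y v] f1[of x] f1[of t] by (simp add: y_def v_def)
          ultimately have "cmod b * norm (y - v) \<le> e * 2" using e by (intro mult_mono) auto
          then show ?thesis by simp
        qed
      qed
      finally show ?thesis by simp
    qed
    then have "norm (l *\<^sub>R k u + (1 - l) *\<^sub>R k (- u) - f) \<le> 4 * e" by (rule norm_bound)
    then show ?thesis using e by (simp add: dist_norm)
  qed
  ultimately show "\<exists>z\<in>convex hull (Delta_points F). dist z f < \<eta>" by blast
qed

theorem theorem4p17:
  fixes F :: "('k::t2_space \<Rightarrow>\<^sub>C 'x::{complex_normed_vector, banach}) set"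
    and A :: "('k \<Rightarrow>\<^sub>C complex) set"
    and \<Gamma> :: "'k set"
  assumes "compact (UNIV :: 'k set)"
    and "uniformly_convex (UNIV :: 'x set)"
    and "function_space F A"
    and "is_Shilov_boundary A \<Gamma>"
    and "{t. t islimpt \<Gamma>} \<inter> Choquet_boundary A \<noteq> {}"
  shows "convex_DLD2P F"
proof -
  obtain x where x: "x islimpt \<Gamma>" "x \<in> Choquet_boundary A" using assms(5) by blast
  \<comment> \<open>This gives the easy inclusion; the other is
    \<open>unit_ball_approx_Delta\<close>.\<close>
  have "Delta_points F \<subseteq> cball 0 1" by (auto simp: Delta_points_def)
  then have "closure (convex hull (Delta_points F)) \<subseteq> cball 0 1"
    by (intro closure_minimal hull_minimal) auto
  then show ?thesis
    using unit_ball_approx_Delta[OF assms(1,3,4) x] by (auto simp: convex_DLD2P_def)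
qed

end
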